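(* Let $n$ be a positive integer and let $X,Y,Z\subset Q_n$ be upward closed set systems with $|X|=|Y|=|Z|=\rho\cdot 2^n$. Let $$S_1=(X\cap Y^c\cap Z^c)\sqcup (X^c\cap Y\cap Z^c)\sqcup (X^c\cap Y^c\cap Z)$$ be the set of points of $Q_n$ lying in exactly one of $X,Y,Z$. Then $$\frac{|S_1|}{2^n}\le 3\rho\cdot\frac{1-\rho}{1+\rho}.$$
   Context: $Q_n$ denotes the power set of $[n]=\{1,2,\dots,n\}$, ordered by inclusion. A set system $X\subset Q_n$ is upward closed if whenever $A\in X$ and $A\subset B\subset [n]$, also $B\in X$. Complements $X^c,Y^c,Z^c$ are taken in $Q_n$. *)

theory Defs
  imports Complex_Main
begin

definition Q :: "nat \<Rightarrow> nat set set" where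
  "Q n = Pow {1..n}"

definition upward_closed :: "nat \<Rightarrow> nat set set \<Rightarrow> bool" where
  "upward_closed n X \<longleftrightarrow>
     X \<subseteq> Q n \<and> (\<forall>A B. A \<in> X \<longrightarrow> A \<subseteq> B \<longrightarrow> B \<subseteq> {1..n} \<longrightarrow> B \<in> X)"

(* The three parts are pairwise disjoint; complements are taken in Q n. *)
definition S1 :: "nat \<Rightarrow> nat set set \<Rightarrow> nat set set \<Rightarrow> nat set set \<Rightarrow> nat set set" where
  "S1 n X Y Z =
     (X \<inter> (Q n - Y) \<inter> (Q n - Z)) \<union>
     ((Q n - X) \<inter> Y \<inter> (Q n - Z)) \<union>
     ((Q n - X) \<inter> (Q n - Y) \<inter> Z)"

end

theory Submission
  imports Defs
begin

text \<open>
  Any two upward closed families are positively correlated (the Harris--Kleitman inequality,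
  \<open>harris_kleitman\<close>); the bound follows by choosing the right pairs. Write \<open>p, q, r\<close> for the densities
  of \<open>X \<inter> Y\<close>, \<open>X \<inter> Z\<close>, \<open>Y \<inter> Z\<close>, let \<open>P = p + q + r\<close>, and write \<open>t\<close> for the density of \<open>X \<inter> Y \<inter> Z\<close>.
  By inclusion-exclusion (\<open>card_S1\<close>) the points in exactly one family have density \<open>3 \<rho> - \<Delta>\<close> with
  \<open>\<Delta> = 2 P - 3 t\<close>, so the claim is \<open>(1 + \<rho>) \<Delta> \<ge> 6 \<rho>\<^sup>2\<close>.

  One always has \<open>\<Delta> \<ge> P\<close>, because \<open>X \<inter> Y \<inter> Z\<close> lies in every pairwise intersection and so \<open>3 t \<le> P\<close>.
  With the estimate \<open>P \<ge> 3 \<rho>\<^sup>2\<close> from correlating the families pairwise, this is too weak. A second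
  bound, good when \<open>P\<close> is small, comes from correlating each family with the union of the other two
  (\<open>harris_kleitman_union\<close>): for \<open>Z\<close> and \<open>X \<union> Y\<close> it reads \<open>q + r - t \<ge> \<rho> (2 \<rho> - p)\<close>, and the three
  inequalities of this kind add up to \<open>\<Delta> \<ge> 6 \<rho>\<^sup>2 - \<rho> P\<close>. Adding \<open>\<rho>\<close> times the first bound
  eliminates \<open>P\<close>.
\<close>

lemma card_split_insert:
  assumes "finite F" "x \<notin> F" "A \<subseteq> Pow (insert x F)"
  shows "card A = card {S \<in> Pow F. S \<in> A} + card {S \<in> Pow F. insert x S \<in> A}"
proof -
  let ?A0 = "{S \<in> Pow F. S \<in> A}" and ?A1 = "{S \<in> Pow F. insert x S \<in> A}"
  have "A \<subseteq> ?A0 \<union> insert x ` ?A1"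
  proof
    fix S assume S: "S \<in> A"
    show "S \<in> ?A0 \<union> insert x ` ?A1"
    proof (cases "x \<in> S")
      case True
      then have "S = insert x (S - {x})" by blast
      moreover from this S assms(3) have "S - {x} \<in> ?A1" by auto
      ultimately show ?thesis by blast
    qed (use S assms(3) in auto)
  qed
  then have "A = ?A0 \<union> insert x ` ?A1" by auto
  have "?A0 \<inter> insert x ` ?A1 = {}" using assms(2) by auto
  moreover have "inj_on (insert x) ?A1"
    using assms(2) by (auto intro!: inj_onI simp: insert_ident subset_iff)
  moreover have "finite ?A0" "finite ?A1" using assms(1) by auto
  ultimately have "card (?A0 \<union> insert x ` ?A1) = card ?A0 + card ?A1"
    by (subst card_Un_disjoint) (simp_all only: card_image finite_imageI)
  with \<open>A = ?A0 \<union> insert x ` ?A1\<close> show ?thesis by (rule arg_cong[THEN trans])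
qed

text \<open>
  Induction on the ground set: sorting the members of an upward
  closed family by whether they contain the new point \<open>x\<close> gives two upward closed families on the
  smaller ground set, of which the one coming from members containing \<open>x\<close> is the larger. Both \<open>A\<close>
  and \<open>B\<close> are thus split in the same order, so Chebyshev's sum inequality combines the two instances
  of the induction hypothesis.
\<close>

lemma harris_kleitman:
  assumes "finite F" "A \<subseteq> Pow F" "B \<subseteq> Pow F"
    and "\<And>S T. S \<in> A \<Longrightarrow> S \<subseteq> T \<Longrightarrow> T \<subseteq> F \<Longrightarrow> T \<in> A"
    and "\<And>S T. S \<in> B \<Longrightarrow> S \<subseteq> T \<Longrightarrow> T \<subseteq> F \<Longrightarrow> T \<in> B"
  shows "card A * card B \<le> 2 ^ card F * card (A \<inter> B)"
  using assms
proof (induction F arbitrary: A B rule: finite_induct)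
  case empty
  then have "A = {} \<or> A = {{}}" "B = {} \<or> B = {{}}" by auto
  then show ?case by auto
next
  case (insert x F)
  define L where "L C = {S \<in> Pow F. S \<in> C}" for C
  define U where "U C = {S \<in> Pow F. insert x S \<in> C}" for C
  have split: "card C = card (L C) + card (U C)" if "C \<subseteq> Pow (insert x F)" for C
    unfolding L_def U_def using card_split_insert[OF insert.hyps(1,2) that] .
  have Int: "L (A \<inter> B) = L A \<inter> L B" "U (A \<inter> B) = U A \<inter> U B"
    by (auto simp: L_def U_def)
  have "card (L A) * card (L B) \<le> 2 ^ card F * card (L A \<inter> L B)"
    by (rule insert.IH) (auto simp: L_def intro: insert.prems(3,4))
  moreover have "card (U A) * card (U B) \<le> 2 ^ card F * card (U A \<inter> U B)"
  proof (rule insert.IH)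
    show "T \<in> U A" if "S \<in> U A" "S \<subseteq> T" "T \<subseteq> F" for S T
      using that insert.prems(3)[of "insert x S" "insert x T"] by (auto simp: U_def)
    show "T \<in> U B" if "S \<in> U B" "S \<subseteq> T" "T \<subseteq> F" for S T
      using that insert.prems(4)[of "insert x S" "insert x T"] by (auto simp: U_def)
  qed (auto simp: U_def)
  ultimately have IH: "card (L A) * card (L B) + card (U A) * card (U B)
      \<le> 2 ^ card F * card (A \<inter> B)"
    using split[OF le_infI1[OF insert.prems(1)], of B] by (simp add: Int distrib_left)
  have fin: "finite (U C)" for C using insert.hyps(1) by (simp add: U_def)
  have "L A \<subseteq> U A" "L B \<subseteq> U B"
    by (auto simp: L_def U_def intro: insert.prems(3,4))
  then have "card (L A) \<le> card (U A)" "card (L B) \<le> card (U B)"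
    by (simp_all add: card_mono fin)
  then obtain a b where "card (U A) = card (L A) + a" "card (U B) = card (L B) + b"
    by (auto simp: le_iff_add)
  then have "(card (L A) + card (U A)) * (card (L B) + card (U B))
      \<le> 2 * (card (L A) * card (L B) + card (U A) * card (U B))"
    by (simp add: algebra_simps)
  also have "\<dots> \<le> 2 * (2 ^ card F * card (A \<inter> B))" using IH by simp
  finally show ?case
    using insert.hyps insert.prems(1,2) by (simp add: split)
qed

lemma harris_kleitman_upward_closed:
  assumes "upward_closed n A" "upward_closed n B"
  shows "real (card A) * real (card B) \<le> 2 ^ n * real (card (A \<inter> B))"
proof -
  have "card A * card B \<le> 2 ^ card {1..n} * card (A \<inter> B)"
    using assms by (intro harris_kleitman) (auto simp: upward_closed_def Q_def)
  then have "real (card A * card B) \<le> real (2 ^ n * card (A \<inter> B))"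
    by (intro of_nat_mono) simp
  then show ?thesis by simp
qed

lemma upward_closed_Un:
  "upward_closed n A \<Longrightarrow> upward_closed n B \<Longrightarrow> upward_closed n (A \<union> B)"
  by (simp add: upward_closed_def)

lemma card_Un_real:
  assumes "finite A" "finite B"
  shows "real (card (A \<union> B)) = real (card A) + real (card B) - real (card (A \<inter> B))"
  using card_Un_Int[OF assms] by linarith

text \<open>
  Harris--Kleitman for \<open>A \<union> B\<close> and \<open>C\<close>, with both unions expanded by inclusion-exclusion. Unlike
  the inequality for two of the families, it limits how much of the pairwise intersections can be
  taken up by the triple intersection.
\<close>

lemma harris_kleitman_union:
  assumes "upward_closed n A" "upward_closed n B" "upward_closed n C"
    and "finite A" "finite B"
  shows "(real (card A) + real (card B) - real (card (A \<inter> B))) * real (card C)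
    \<le> 2 ^ n * (real (card (A \<inter> C)) + real (card (B \<inter> C)) - real (card (A \<inter> B \<inter> C)))"
proof -
  have "(A \<union> B) \<inter> C = (A \<inter> C) \<union> (B \<inter> C)" "(A \<inter> C) \<inter> (B \<inter> C) = A \<inter> B \<inter> C" by auto
  then show ?thesis
    using harris_kleitman_upward_closed[OF upward_closed_Un[OF assms(1,2)] assms(3)] assms(4,5)
    by (simp add: card_Un_real)
qed

lemma card_S1:
  assumes "X \<subseteq> Q n" "Y \<subseteq> Q n" "Z \<subseteq> Q n"
  shows "real (card (S1 n X Y Z)) = real (card X) + real (card Y) + real (card Z)
    - 2 * (real (card (X \<inter> Y)) + real (card (X \<inter> Z)) + real (card (Y \<inter> Z)))
    + 3 * real (card (X \<inter> Y \<inter> Z))"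
proof -
  have fin: "finite X" "finite Y" "finite Z"
    using assms by (auto simp: Q_def intro: finite_subset)
  have only: "real (card (A - B - C)) = real (card A) - real (card (A \<inter> B))
      - real (card (A \<inter> C)) + real (card (A \<inter> B \<inter> C))" if "finite A" for A B C :: "nat set set"
  proof -
    have "card A = card (A \<inter> (B \<union> C)) + card (A - (B \<union> C))"
      using that card_Int_Diff by blast
    moreover have "A - B - C = A - (B \<union> C)" "A \<inter> (B \<union> C) = (A \<inter> B) \<union> (A \<inter> C)"
      "(A \<inter> B) \<inter> (A \<inter> C) = A \<inter> B \<inter> C" by auto
    ultimately show ?thesis using that card_Un_real[of "A \<inter> B" "A \<inter> C"] by simp
  qed
  have "S1 n X Y Z = (X - Y - Z) \<union> ((Y - X - Z) \<union> (Z - X - Y))"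
    using assms by (auto simp: S1_def)
  moreover have "(X - Y - Z) \<inter> ((Y - X - Z) \<union> (Z - X - Y)) = {}"
    "(Y - X - Z) \<inter> (Z - X - Y) = {}" by auto
  ultimately have "card (S1 n X Y Z) = card (X - Y - Z) + (card (Y - X - Z) + card (Z - X - Y))"
    using fin by (simp add: card_Un_disjoint)
  moreover have "Y \<inter> X = X \<inter> Y" "Z \<inter> X = X \<inter> Z" "Z \<inter> Y = Y \<inter> Z"
    "Z \<inter> X \<inter> Y = X \<inter> Y \<inter> Z" by auto
  ultimately show ?thesis
    using only[OF fin(1), of Y Z] only[OF fin(2), of X Z] only[OF fin(3), of X Y] by simp
qed

theorem theorem3:
  fixes n :: nat and X Y Z :: "nat set set" and \<rho> :: real
  assumes "n \<ge> 1"
    and "upward_closed n X" and "upward_closed n Y" and "upward_closed n Z"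
    and "real (card X) = \<rho> * 2 ^ n"
    and "real (card Y) = \<rho> * 2 ^ n"
    and "real (card Z) = \<rho> * 2 ^ n"
  shows "real (card (S1 n X Y Z)) / 2 ^ n \<le> 3 * \<rho> * ((1 - \<rho>) / (1 + \<rho>))"
proof -
  note up = assms(2-4)
  define N :: real where "N = 2 ^ n"
  have "N > 0" by (simp add: N_def)
  \<comment> \<open>cardinalities, that is, the densities of the introduction scaled by \<open>N\<close>\<close>
  define p q r t where "p = real (card (X \<inter> Y))" and "q = real (card (X \<inter> Z))"
    and "r = real (card (Y \<inter> Z))" and "t = real (card (X \<inter> Y \<inter> Z))"
  have sub: "X \<subseteq> Q n" "Y \<subseteq> Q n" "Z \<subseteq> Q n"
    using up by (auto simp: upward_closed_def)
  have fin: "finite X" "finite Y" "finite Z"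
    using sub by (auto simp: Q_def intro: finite_subset)
  have eqs: "Y \<inter> X = X \<inter> Y" "Z \<inter> X = X \<inter> Z" "Z \<inter> Y = Y \<inter> Z"
    "X \<inter> Z \<inter> Y = X \<inter> Y \<inter> Z" "Y \<inter> Z \<inter> X = X \<inter> Y \<inter> Z" by auto
  have card: "real (card X) = \<rho> * N" "real (card Y) = \<rho> * N" "real (card Z) = \<rho> * N"
    using assms by (simp_all add: N_def)
  have "0 \<le> \<rho> * N" using card(1) by (metis of_nat_0_le_iff)
  then have "\<rho> \<ge> 0" using \<open>N > 0\<close> by (simp add: zero_le_mult_iff)
  define \<Delta> where "\<Delta> = 2 * (p + q + r) - 3 * t"
  have "N * ((2 * \<rho> * N - p) * \<rho>) \<le> N * (q + r - t)"
    "N * ((2 * \<rho> * N - q) * \<rho>) \<le> N * (p + r - t)"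
    "N * ((2 * \<rho> * N - r) * \<rho>) \<le> N * (p + q - t)"
    using harris_kleitman_union[OF up(1,2,3) fin(1,2)]
      harris_kleitman_union[OF up(1,3,2) fin(1,3)] harris_kleitman_union[OF up(2,3,1) fin(2,3)]
    by (simp_all add: eqs card p_def q_def r_def t_def N_def[symmetric] algebra_simps)
  then have "(2 * \<rho> * N - p) * \<rho> \<le> q + r - t" "(2 * \<rho> * N - q) * \<rho> \<le> p + r - t"
    "(2 * \<rho> * N - r) * \<rho> \<le> p + q - t"
    using \<open>N > 0\<close> by simp_all
  then have small: "6 * \<rho>\<^sup>2 * N - \<rho> * (p + q + r) \<le> \<Delta>"
    by (simp add: \<Delta>_def algebra_simps power2_eq_square)
  have "t \<le> p" "t \<le> q" "t \<le> r"
    unfolding p_def q_def r_def t_def using fin by (auto intro!: card_mono)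
  then have "p + q + r \<le> \<Delta>" by (simp add: \<Delta>_def)
  then have "\<rho> * (p + q + r) \<le> \<rho> * \<Delta>" using \<open>\<rho> \<ge> 0\<close> by (rule mult_left_mono)
  with small have key: "6 * \<rho>\<^sup>2 * N \<le> (1 + \<rho>) * \<Delta>" by (simp add: algebra_simps)
  have S1: "real (card (S1 n X Y Z)) = 3 * \<rho> * N - \<Delta>"
    using card_S1[OF sub] by (simp add: card \<Delta>_def p_def q_def r_def t_def)
  have "(1 + \<rho>) * real (card (S1 n X Y Z)) = 3 * \<rho> * (1 + \<rho>) * N - (1 + \<rho>) * \<Delta>"
    unfolding S1 by (simp add: algebra_simps)
  also have "\<dots> \<le> 3 * \<rho> * (1 + \<rho>) * N - 6 * \<rho>\<^sup>2 * N" using key by simp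
  finally have "(1 + \<rho>) * real (card (S1 n X Y Z)) \<le> 3 * \<rho> * (1 - \<rho>) * N"
    by (simp add: algebra_simps power2_eq_square)
  then show ?thesis
    using \<open>N > 0\<close> \<open>\<rho> \<ge> 0\<close> unfolding N_def[symmetric] by (simp add: field_simps)
qed

end
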